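(* Let $d,n\in\mathbb{N}$. Then there exists a set $U\subseteq\mathbb{R}^d$ of $n$ points such that $R(\mathsf{CSD}_U)=\Omega(d\log(n/d))$.
   Context: $\mathsf{CSD}_U:2^U\times 2^U\to\{0,1\}$ is the Convex Set Disjointness function: Alice holds $X\subseteq U$, Bob holds $Y\subseteq U$, and $\mathsf{CSD}_U(X,Y)=0$ if $\mathrm{conv}(X)\cap\mathrm{conv}(Y)\neq\emptyset$ and $1$ otherwise. $R(f)$ denotes the randomized two-party communication complexity of $f$ with error probability $1/3$.
   Formalization: The formal theorem assumes d ≥ 2: for d = 1 the claim fails, since CSD_U on a line reduces to two Greater-Than comparisons of ranks, with randomized complexity O(log log n), and for d = 0 the ratio n/d is undefined. *)

theory Defs
  imports "HOL-Analysis.Finite_Function_Topology" "HOL-Probability.Probability"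
begin

text \<open>
  The dimension is quantified inside the statement, so it cannot be a type. Space \<open>\<real>\<^sup>d\<close> is the
  subspace of the real vector space of finitely supported sequences spanned by the first
  \<open>d\<close> coordinates; convex hulls of subsets of it are therefore the library's.
\<close>

definition Rspace :: "nat \<Rightarrow> (nat, real) poly_mapping set" where
  "Rspace d = {x. Poly_Mapping.keys x \<subseteq> {..<d}}"

definition CSD :: "'v::real_vector set \<Rightarrow> 'v set \<Rightarrow> nat" where
  "CSD X Y = (if convex hull X \<inter> convex hull Y \<noteq> {} then 0 else 1)"

text \<open>
  Deterministic two-party protocol trees: an inner node belongs to the party who sends the next
  bit, computed from that party's own input (the node itself encodes the transcript so far).
  The first subtree is taken if the bit is true.
\<close>

datatype ('a, 'b, 'c) protocol =
    Output 'c
  | Alice "'a \<Rightarrow> bool" "('a, 'b, 'c) protocol" "('a, 'b, 'c) protocol"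
  | Bob "'b \<Rightarrow> bool" "('a, 'b, 'c) protocol" "('a, 'b, 'c) protocol"

primrec run :: "('a, 'b, 'c) protocol \<Rightarrow> 'a \<Rightarrow> 'b \<Rightarrow> 'c" where
  "run (Output z) x y = z"
| "run (Alice p l r) x y = (if p x then run l x y else run r x y)"
| "run (Bob q l r) x y = (if q y then run l x y else run r x y)"

primrec cost :: "('a, 'b, 'c) protocol \<Rightarrow> nat" where
  "cost (Output z) = 0"
| "cost (Alice p l r) = Suc (max (cost l) (cost r))"
| "cost (Bob q l r) = Suc (max (cost l) (cost r))"

text \<open>
  A randomized protocol is a probability distribution on deterministic protocols (public coins).
  Private coins are the special case in which the functions at Alice's nodes and those at Bob's
  nodes depend on independent random strings, so a lower bound on \<open>R\<close> also holds for them.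
  The sets \<open>A\<close> and \<open>B\<close> are the possible inputs; the cost is the worst case over coins and inputs.
\<close>

definition computes_with_error ::
    "real \<Rightarrow> 'a set \<Rightarrow> 'b set \<Rightarrow> ('a \<Rightarrow> 'b \<Rightarrow> 'c) \<Rightarrow> ('a, 'b, 'c) protocol pmf \<Rightarrow> bool" where
  "computes_with_error \<epsilon> A B f P \<longleftrightarrow>
    (\<forall>x\<in>A. \<forall>y\<in>B. measure_pmf.prob P {t. run t x y \<noteq> f x y} \<le> \<epsilon>)"

definition R :: "'a set \<Rightarrow> 'b set \<Rightarrow> ('a \<Rightarrow> 'b \<Rightarrow> 'c) \<Rightarrow> nat" where
  "R A B f = (LEAST k. \<exists>P. (\<forall>t\<in>set_pmf P. cost t \<le> k) \<and> computes_with_error (1/3) A B f P)"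

text \<open>For finite input sets the minimum in the definition of \<open>R\<close> ranges over a nonempty set.\<close>

lemma finite_deterministic_protocol:
  assumes "finite A" "finite B"
  shows "\<exists>t. \<forall>x\<in>A. \<forall>y\<in>B. run t x y = f x y"
  using assms(1)
proof induction
  case (insert a A)
  have "\<exists>t::('a, 'b, 'c) protocol. \<forall>x. \<forall>y\<in>B. run t x y = f a y"
    using assms(2)
  proof induction
    case (insert b B)
    then obtain t :: "('a, 'b, 'c) protocol" where "\<forall>x. \<forall>y\<in>B. run t x y = f a y"
      by blast
    then have "\<forall>x. \<forall>y\<in>insert b B. run (Bob (\<lambda>y. y = b) (Output (f a b)) t) x y = f a y"
      by simp
    then show ?case by blast
  qed simp
  then obtain s :: "('a, 'b, 'c) protocol" where s: "\<forall>x. \<forall>y\<in>B. run s x y = f a y"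
    by blast
  from insert obtain t where "\<forall>x\<in>A. \<forall>y\<in>B. run t x y = f x y"
    by blast
  with s have "\<forall>x\<in>insert a A. \<forall>y\<in>B. run (Alice (\<lambda>x. x = a) s t) x y = f x y"
    by simp
  then show ?case by blast
qed simp

lemma R_attained:
  assumes "finite A" "finite B"
  shows "\<exists>P. (\<forall>t\<in>set_pmf P. cost t \<le> R A B f) \<and> computes_with_error (1/3) A B f P"
proof -
  obtain t where "\<forall>x\<in>A. \<forall>y\<in>B. run t x y = f x y"
    using finite_deterministic_protocol[OF assms] by blast
  then have "computes_with_error (1/3) A B f (return_pmf t)"
    by (simp add: computes_with_error_def indicator_def)
  then have "\<exists>k P. (\<forall>t\<in>set_pmf P. cost t \<le> k) \<and> computes_with_error (1/3) A B f P"
    by (intro exI[of _ "cost t"] exI[of _ "return_pmf t"]) simp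
  then show ?thesis
    unfolding R_def by (rule LeastI_ex)
qed

end

theory Submission
  imports Defs
begin

text \<open>
  Alice holds \<open>x \<in> [N]\<^sup>k\<close> and Bob a set \<open>B \<subseteq> [k] \<times> [N]\<close>; the parity of \<open>|{i. (i, x i) \<in> B}|\<close> is a sign
  matrix with orthogonal rows, so by Lindsey's lemma its discrepancy is at most \<open>N\<^bsup>-k/2\<^esup>\<close> and its
  randomized complexity is \<open>\<Omega>(k log N)\<close>.

  Convex set disjointness contains this function for \<open>k = \<Omega>(d)\<close> and \<open>N = \<Omega>(n/d)\<close>. View the vectors
  \<open>u - v\<close> of Alice as edges from \<open>u\<close> to \<open>v\<close> and those of Bob as edges from \<open>v\<close> to \<open>u\<close>: a directed
  cycle that alternates between the two yields a common point of the hulls, and a linear functional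
  that decreases along all edges separates them. The edges simulate an automaton that computes the
  parity bit by bit and whose accepting final node is glued to the initial one. At level \<open>i\<close>
  Alice moves from the current state to the point \<open>x i\<close> of a parabola attached to that state, and Bob
  moves from every point \<open>y\<close> of the parabola to the next state determined by \<open>(i, y) \<in> B\<close>. As the
  points of a parabola are in convex position, only the move from \<open>y = x i\<close> continues Alice's.
  For bounded \<open>d\<close> a single parabola in the plane suffices.
\<close>

subsection \<open>Discrepancy\<close>

text \<open>Lindsey's lemma. Cauchy-Schwarz over the columns in \<open>T\<close> reduces the claim
  to the squared norm of the sum of the rows in \<open>S\<close>, and orthogonality leaves only its
  diagonal terms.\<close>

lemma rectangle_sum_bound:
  fixes H :: "'a \<Rightarrow> 'b \<Rightarrow> real"
  assumes fin: "finite A" "finite B"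
    and sq: "\<And>a b. a \<in> A \<Longrightarrow> b \<in> B \<Longrightarrow> (H a b)\<^sup>2 = 1"
    and orth: "\<And>a a'. a \<in> A \<Longrightarrow> a' \<in> A \<Longrightarrow> a \<noteq> a' \<Longrightarrow> (\<Sum>b\<in>B. H a b * H a' b) = 0"
    and ST: "S \<subseteq> A" "T \<subseteq> B"
  shows "\<bar>\<Sum>a\<in>S. \<Sum>b\<in>T. H a b\<bar> \<le> sqrt (card S * card T * card B)"
proof -
  have finS: "finite S" and finT: "finite T"
    using ST fin finite_subset by auto
  have "(\<Sum>b\<in>B. (\<Sum>a\<in>S. H a b)\<^sup>2) = (\<Sum>b\<in>B. \<Sum>a\<in>S. \<Sum>a'\<in>S. H a b * H a' b)"
    by (simp add: power2_eq_square sum_product)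
  also have "\<dots> = (\<Sum>a\<in>S. \<Sum>a'\<in>S. \<Sum>b\<in>B. H a b * H a' b)"
    by (subst sum.swap) (intro sum.cong refl sum.swap)
  also have "\<dots> = (\<Sum>a\<in>S. \<Sum>a'\<in>S. if a' = a then real (card B) else 0)"
  proof (intro sum.cong refl)
    fix a a' assume "a \<in> S" "a' \<in> S"
    then have "a \<in> A" "a' \<in> A" using ST by auto
    then show "(\<Sum>b\<in>B. H a b * H a' b) = (if a' = a then real (card B) else 0)"
      using orth[of a a'] sq[of a] by (auto simp: power2_eq_square)
  qed
  also have "\<dots> = card S * card B"
    using finS by simp
  finally have norm: "(\<Sum>b\<in>B. (\<Sum>a\<in>S. H a b)\<^sup>2) = card S * card B" .
  have "(\<Sum>a\<in>S. \<Sum>b\<in>T. H a b)\<^sup>2 = (\<Sum>b\<in>T. \<Sum>a\<in>S. H a b)\<^sup>2"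
    by (subst sum.swap) simp
  also have "\<dots> \<le> (\<Sum>b\<in>T. (\<Sum>a\<in>S. H a b)\<^sup>2) * card T"
    by (rule sum_squared_le_sum_of_squares)
  also have "\<dots> \<le> (\<Sum>b\<in>B. (\<Sum>a\<in>S. H a b)\<^sup>2) * card T"
    by (intro mult_right_mono sum_mono2) (use fin ST in auto)
  also have "\<dots> = card S * card T * card B"
    by (simp add: norm)
  finally show ?thesis
    by (metis real_sqrt_abs real_sqrt_le_iff)
qed

text \<open>Outputs other than \<open>0\<close> and \<open>1\<close> are always wrong; the weight \<open>0\<close> overestimates them.\<close>

definition vote :: "nat \<Rightarrow> real" where
  "vote z = (if z = 0 then - 1 else if z = 1 then 1 else 0)"

text \<open>The inputs reaching a leaf form a rectangle, and there are at most
  \<open>2 ^ cost t\<close> leaves.\<close>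

lemma protocol_correlation:
  fixes H :: "'a \<Rightarrow> 'b \<Rightarrow> real" and t :: "('c, 'd, nat) protocol"
  assumes fin: "finite A" "finite B"
    and bound: "\<And>S T. S \<subseteq> A \<Longrightarrow> T \<subseteq> B \<Longrightarrow> \<bar>\<Sum>a\<in>S. \<Sum>b\<in>T. H a b\<bar> \<le> M"
    and "S \<subseteq> A" "T \<subseteq> B"
  shows "(\<Sum>a\<in>S. \<Sum>b\<in>T. vote (run t (\<alpha> a) (\<beta> b)) * H a b) \<le> 2 ^ cost t * M"
  using assms(4,5)
proof (induction t arbitrary: S T)
  case (Output z)
  have "(\<Sum>a\<in>S. \<Sum>b\<in>T. vote z * H a b) = vote z * (\<Sum>a\<in>S. \<Sum>b\<in>T. H a b)"
    by (simp add: sum_distrib_left)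
  also have "\<dots> \<le> M"
    using bound[OF Output] by (auto simp: vote_def)
  finally show ?case by simp
next
  case (Alice p l r)
  have M: "0 \<le> M" using bound[of "{}" "{}"] by simp
  let ?F = "\<lambda>t S. \<Sum>a\<in>S. \<Sum>b\<in>T. vote (run t (\<alpha> a) (\<beta> b)) * H a b"
  have "finite S" using Alice.prems fin finite_subset by auto
  then have "?F (Alice p l r) S = ?F (Alice p l r) (S \<inter> {a. p (\<alpha> a)}) + ?F (Alice p l r) (S - {a. p (\<alpha> a)})"
    by (rule sum.Int_Diff)
  also have "\<dots> = ?F l (S \<inter> {a. p (\<alpha> a)}) + ?F r (S - {a. p (\<alpha> a)})"
    by (intro arg_cong2[of _ _ _ _ "(+)"] sum.cong) auto
  also have "\<dots> \<le> 2 ^ cost l * M + 2 ^ cost r * M"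
    using Alice.prems by (intro add_mono Alice.IH) auto
  also have "\<dots> \<le> 2 ^ max (cost l) (cost r) * M + 2 ^ max (cost l) (cost r) * M"
    using M by (intro add_mono mult_right_mono power_increasing) auto
  also have "\<dots> = 2 ^ cost (Alice p l r) * M" by simp
  finally show ?case .
next
  case (Bob q l r)
  have M: "0 \<le> M" using bound[of "{}" "{}"] by simp
  let ?F = "\<lambda>t T. \<Sum>a\<in>S. \<Sum>b\<in>T. vote (run t (\<alpha> a) (\<beta> b)) * H a b"
  have "finite T" using Bob.prems fin finite_subset by auto
  then have "?F (Bob q l r) T = ?F (Bob q l r) (T \<inter> {b. q (\<beta> b)}) + ?F (Bob q l r) (T - {b. q (\<beta> b)})"
    by (simp add: sum.Int_Diff[of T _ "{b. q (\<beta> b)}"] sum.distrib)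
  also have "\<dots> = ?F l (T \<inter> {b. q (\<beta> b)}) + ?F r (T - {b. q (\<beta> b)})"
    by (intro arg_cong2[of _ _ _ _ "(+)"] sum.cong) auto
  also have "\<dots> \<le> 2 ^ cost l * M + 2 ^ cost r * M"
    using Bob.prems by (intro add_mono Bob.IH) auto
  also have "\<dots> \<le> 2 ^ max (cost l) (cost r) * M + 2 ^ max (cost l) (cost r) * M"
    using M by (intro add_mono mult_right_mono power_increasing) auto
  also have "\<dots> = 2 ^ cost (Bob q l r) * M" by simp
  finally show ?case .
qed

text \<open>On each input pair the expected correlation is at least \<open>1 - 2/3\<close>;
  exchanging sums and expectation leaves a bound for each deterministic protocol.\<close>

lemma randomized_cost_discrepancy:
  fixes H :: "'a \<Rightarrow> 'b \<Rightarrow> real" and f :: "'c \<Rightarrow> 'd \<Rightarrow> nat"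
  assumes fin: "finite A" "finite B"
    and maps: "\<And>a. a \<in> A \<Longrightarrow> \<alpha> a \<in> X" "\<And>b. b \<in> B \<Longrightarrow> \<beta> b \<in> Y"
    and f: "\<And>a b. a \<in> A \<Longrightarrow> b \<in> B \<Longrightarrow> f (\<alpha> a) (\<beta> b) \<in> {0, 1}"
    and H: "\<And>a b. a \<in> A \<Longrightarrow> b \<in> B \<Longrightarrow> H a b = vote (f (\<alpha> a) (\<beta> b))"
    and bound: "\<And>S T. S \<subseteq> A \<Longrightarrow> T \<subseteq> B \<Longrightarrow> \<bar>\<Sum>a\<in>S. \<Sum>b\<in>T. H a b\<bar> \<le> M"
    and cost: "\<And>t. t \<in> set_pmf P \<Longrightarrow> cost t \<le> r"
    and P: "computes_with_error (1/3) X Y f P"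
  shows "card A * card B / 3 \<le> 2 ^ r * M"
proof -
  let ?g = "\<lambda>a b t. vote (run t (\<alpha> a) (\<beta> b)) * H a b"
  have H_abs: "\<bar>H a b\<bar> \<le> 1" if "a \<in> A" "b \<in> B" for a b
    using H[OF that] by (auto simp: vote_def)
  have int: "integrable (measure_pmf P) (?g a b)" if "a \<in> A" "b \<in> B" for a b
    by (rule measure_pmf.integrable_const_bound[where B = 1])
      (use H_abs[OF that] in \<open>auto simp: vote_def\<close>)
  have one: "1/3 \<le> measure_pmf.expectation P (?g a b)" if ab: "a \<in> A" "b \<in> B" for a b
  proof -
    let ?E = "{t. run t (\<alpha> a) (\<beta> b) \<noteq> f (\<alpha> a) (\<beta> b)}"
    have err: "measure_pmf.prob P ?E \<le> 1/3"
      using P maps ab by (auto simp: computes_with_error_def)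
    have E: "integrable (measure_pmf P) (\<lambda>t. indicator ?E t :: real)"
      by (rule measure_pmf.integrable_const_bound[where B = 1]) (auto simp: indicator_def)
    have "1/3 \<le> 1 - 2 * measure_pmf.prob P ?E" using err by simp
    also have "\<dots> = measure_pmf.expectation P (\<lambda>t. 1 - 2 * indicator ?E t)"
      using E by simp
    also have "\<dots> \<le> measure_pmf.expectation P (?g a b)"
    \<comment> \<open>A correct output gives 1, a wrong bit gives -1 and any other output gives
      0.\<close>
    proof (rule integral_mono)
      show "1 - 2 * indicator ?E t \<le> ?g a b t" for t
        using f[OF ab] H[OF ab] by (auto simp: vote_def indicator_def)
    qed (use E int[OF ab] in simp_all)
    finally show ?thesis .
  qed
  have "card A * card B / 3 = (\<Sum>a\<in>A. \<Sum>b\<in>B. 1/3 :: real)"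
    by simp
  also have "\<dots> \<le> (\<Sum>a\<in>A. \<Sum>b\<in>B. measure_pmf.expectation P (?g a b))"
    by (intro sum_mono one)
  also have "\<dots> = measure_pmf.expectation P (\<lambda>t. \<Sum>a\<in>A. \<Sum>b\<in>B. ?g a b t)"
    using int by (simp add: Bochner_Integration.integral_sum)
  also have "\<dots> \<le> 2 ^ r * M"
  proof (rule measure_pmf.integral_le_const)
    show "AE t in measure_pmf P. (\<Sum>a\<in>A. \<Sum>b\<in>B. ?g a b t) \<le> 2 ^ r * M"
    proof (subst AE_measure_pmf_iff, rule ballI)
      fix t assume t: "t \<in> set_pmf P"
      have "(\<Sum>a\<in>A. \<Sum>b\<in>B. ?g a b t) \<le> 2 ^ cost t * M"
        by (rule protocol_correlation[OF fin bound]) auto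
      also have "\<dots> \<le> 2 ^ r * M"
        using cost[OF t] bound[of "{}" "{}"] by (intro mult_right_mono power_increasing) auto
      finally show "(\<Sum>a\<in>A. \<Sum>b\<in>B. ?g a b t) \<le> 2 ^ r * M" .
    qed
  qed (use int in simp)
  finally show ?thesis .
qed

text \<open>A protocol of cost 0 has a constant output, so it errs on one of the two pairs, yet the
  two error probabilities sum to at most 2/3.\<close>

lemma R_pos:
  assumes fin: "finite X" "finite Y"
    and "x \<in> X" "y \<in> Y" "x' \<in> X" "y' \<in> Y" and ne: "f x y \<noteq> f x' y'"
  shows "0 < R X Y f"
proof (rule ccontr)
  assume "\<not> 0 < R X Y f"
  then obtain P where cost: "\<And>t. t \<in> set_pmf P \<Longrightarrow> cost t = 0"
    and P: "computes_with_error (1/3) X Y f P"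
    using R_attained[OF fin, of f] by auto
  let ?E = "\<lambda>x y. {t. run t x y \<noteq> f x y}"
  have "run t x y = run t x' y'" if "t \<in> set_pmf P" for t
    using cost[OF that] by (cases t) auto
  then have "1 = measure_pmf.prob P (?E x y \<union> ?E x' y')"
    using ne by (subst eq_commute, subst measure_pmf.prob_eq_1) (auto simp: AE_measure_pmf_iff)
  also have "\<dots> \<le> measure_pmf.prob P (?E x y) + measure_pmf.prob P (?E x' y')"
    by (rule measure_Un_le) auto
  also have "\<dots> \<le> 1/3 + 1/3"
    using P assms by (intro add_mono) (auto simp: computes_with_error_def)
  finally show False by simp
qed

section \<open>The parity function and its communication complexity\<close>

definition parity :: "nat \<Rightarrow> (nat \<Rightarrow> nat) \<Rightarrow> (nat \<times> nat) set \<Rightarrow> bool" where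
  "parity i x B \<longleftrightarrow> odd (card {j\<in>{..<i}. (j, x j) \<in> B})"

lemma parity_0 [simp]: "\<not> parity 0 x B"
  by (simp add: parity_def)

lemma parity_Suc [simp]: "parity (Suc i) x B \<longleftrightarrow> (parity i x B \<noteq> ((i, x i) \<in> B))"
proof -
  have "{j\<in>{..<Suc i}. (j, x j) \<in> B} =
      {j\<in>{..<i}. (j, x j) \<in> B} \<union> (if (i, x i) \<in> B then {i} else {})"
    by (auto simp: less_Suc_eq)
  then show ?thesis
    by (auto simp: parity_def)
qed

lemma parity_sign_eq_prod:
  "(if parity i x B then - 1 else 1 :: real) = (\<Prod>j<i. if (j, x j) \<in> B then - 1 else 1)"
  by (induction i) (auto split: if_splits)

text \<open>Toggling \<open>(i, x i)\<close> at a position \<open>i\<close> where the rows differ is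
  an involution that negates the first sign and preserves the second, so the sum equals its own
  negative.\<close>

lemma parity_orthogonal:
  assumes x: "x \<in> {..<k} \<rightarrow>\<^sub>E {..<N}" and x': "x' \<in> {..<k} \<rightarrow>\<^sub>E {..<N}" and ne: "x \<noteq> x'"
  shows "(\<Sum>B\<in>Pow ({..<k} \<times> {..<N}). (if parity k x B then - 1 else 1) * (if parity k x' B then - 1 else 1 :: real)) = 0"
    (is "sum ?g ?P = 0")
proof -
  obtain i where i: "i < k" "x i \<noteq> x' i"
    using PiE_ext[OF x x'] ne by auto
  define flip where "flip B = (B - {(i, x i)}) \<union> ({(i, x i)} - B)" for B
  have bij: "bij_betw flip ?P ?P"
    using i x by (intro bij_betw_byWitness[of _ flip]) (auto simp: flip_def)
  have inv: "?g (flip B) = - ?g B" for B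
  proof -
    have "(\<Prod>j<k. if (j, x j) \<in> flip B then - 1 else 1 :: real) =
        - (\<Prod>j<k. if (j, x j) \<in> B then - 1 else 1)"
    proof -
      have "(\<Prod>j\<in>{..<k} - {i}. if (j, x j) \<in> flip B then - 1 else 1 :: real) =
          (\<Prod>j\<in>{..<k} - {i}. if (j, x j) \<in> B then - 1 else 1)"
        by (intro prod.cong) (auto simp: flip_def)
      then show ?thesis
        using i by (simp add: prod.remove[of "{..<k}" i] flip_def)
    qed
    moreover have "(\<Prod>j<k. if (j, x' j) \<in> flip B then - 1 else 1 :: real) =
        (\<Prod>j<k. if (j, x' j) \<in> B then - 1 else 1)"
      using i by (intro prod.cong) (auto simp: flip_def)
    ultimately show ?thesis
      by (simp add: parity_sign_eq_prod)
  qed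
  have "sum ?g ?P = sum (\<lambda>B. ?g (flip B)) ?P"
    using sum.reindex_bij_betw[OF bij, of ?g] by simp
  then have "sum ?g ?P = - sum ?g ?P"
    by (simp only: inv sum_negf)
  then show ?thesis by simp
qed

lemma R_ge_parity:
  fixes f :: "'c \<Rightarrow> 'd \<Rightarrow> nat"
  assumes k: "0 < k" and N: "0 < N" and fin: "finite X" "finite Y"
    and maps: "\<And>x. x \<in> {..<k} \<rightarrow>\<^sub>E {..<N} \<Longrightarrow> \<alpha> x \<in> X"
      "\<And>B. B \<subseteq> {..<k} \<times> {..<N} \<Longrightarrow> \<beta> B \<in> Y"
    and f: "\<And>x B. x \<in> {..<k} \<rightarrow>\<^sub>E {..<N} \<Longrightarrow> B \<subseteq> {..<k} \<times> {..<N} \<Longrightarrow>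
      f (\<alpha> x) (\<beta> B) = (if parity k x B then 0 else 1)"
  shows "k * log 2 N / 10 \<le> R X Y f"
proof -
  let ?A = "{..<k} \<rightarrow>\<^sub>E {..<N}" and ?B = "Pow ({..<k} \<times> {..<N})"
  let ?H = "\<lambda>x B. if parity k x B then - 1 else 1 :: real"
  have finA: "finite ?A" and finB: "finite ?B"
    by (auto intro: finite_PiE)
  have cardA: "card ?A = N ^ k"
    by (simp add: card_PiE)
  \<comment> \<open>Being at least 1, the complexity absorbs the additive constant
    \<open>log 2 3\<close> at the end.\<close>
  have pos: "0 < R X Y f"
  proof -
    define x where "x = (\<lambda>i\<in>{..<k}. 0::nat)"
    have x: "x \<in> ?A" using N by (auto simp: x_def)
    have "{j\<in>{..<k}. (j, x j) \<in> {(0, 0)}} = {0}"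
      using k by (auto simp: x_def)
    then have "parity k x {(0, 0)}" "\<not> parity k x {}"
      by (simp_all add: parity_def)
    then have "f (\<alpha> x) (\<beta> {(0, 0)}) \<noteq> f (\<alpha> x) (\<beta> {})"
      using f[OF x, of "{(0, 0)}"] f[OF x, of "{}"] k N by auto
    moreover have "\<beta> {(0, 0)} \<in> Y" "\<beta> {} \<in> Y"
      using maps(2)[of "{(0, 0)}"] maps(2)[of "{}"] k N by auto
    ultimately show ?thesis
      using R_pos[OF fin] maps(1)[OF x] by metis
  qed
  let ?r = "R X Y f"
  obtain P where cost: "\<forall>t\<in>set_pmf P. cost t \<le> ?r" and P: "computes_with_error (1/3) X Y f P"
    using R_attained[OF fin] by blast
  have bound: "\<bar>\<Sum>x\<in>S. \<Sum>B\<in>T. ?H x B\<bar> \<le> sqrt (card ?A) * card ?B" if "S \<subseteq> ?A" "T \<subseteq> ?B" for S T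
  proof -
    have "\<bar>\<Sum>x\<in>S. \<Sum>B\<in>T. ?H x B\<bar> \<le> sqrt (card S * card T * card ?B)"
      by (rule rectangle_sum_bound[OF finA finB _ _ that]) (use parity_orthogonal in auto)
    also have "\<dots> \<le> sqrt (card ?A * card ?B * card ?B)"
      by (intro real_sqrt_le_mono of_nat_mono mult_mono card_mono that finA finB) auto
    also have "\<dots> = sqrt (card ?A) * card ?B"
      by (simp add: real_sqrt_mult)
    finally show ?thesis .
  qed
  have "card ?A * card ?B / 3 \<le> 2 ^ ?r * (sqrt (card ?A) * card ?B)"
    by (rule randomized_cost_discrepancy[OF finA finB maps _ _ bound _ P])
      (use cost f in \<open>auto simp: vote_def split: if_splits\<close>)
  moreover have "0 < real (card ?B)"
    using finB by (simp add: card_Pow)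
  ultimately have "card ?A / 3 \<le> 2 ^ ?r * sqrt (card ?A)"
    by (simp add: field_simps)
  then have "sqrt (card ?A) * sqrt (card ?A) \<le> (3 * 2 ^ ?r) * sqrt (card ?A)"
    by simp
  moreover have spos: "0 < sqrt (card ?A)"
    using N cardA by simp
  ultimately have "sqrt (card ?A) \<le> 3 * 2 ^ ?r"
    by (rule mult_right_le_imp_le)
  then have "log 2 (sqrt (card ?A)) \<le> log 2 (3 * 2 ^ ?r)"
    using spos by (subst log_le_cancel_iff) auto
  also have "\<dots> = log 2 3 + ?r"
    by (simp add: log_mult log_nat_power)
  \<comment> \<open>Because \<open>3 ^ 5 = 243\<close> and \<open>2 ^ 8 = 256\<close>.\<close>
  also have "log 2 (3::real) \<le> 8/5"
  proof -
    have "(5::nat) * log 2 3 = log 2 (3 ^ 5)"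
      by (subst log_nat_power) auto
    also have "\<dots> \<le> log 2 (2 ^ 8)"
      by (subst log_le_cancel_iff) auto
    also have "\<dots> = 8"
      by (subst log_nat_power) auto
    finally show ?thesis by simp
  qed
  also have "log 2 (sqrt (card ?A)) = k * log 2 N / 2"
    using N by (simp add: cardA sqrt_def log_root log_nat_power)
  finally have "k * log 2 N / 2 \<le> 8/5 + ?r" by simp
  moreover have "1 \<le> real ?r" using pos by simp
  ultimately show ?thesis by linarith
qed

subsection \<open>Embedding into convex set disjointness\<close>

text \<open>The deleted rules turn the basis vector of index \<open>0\<close> into a ring constant.\<close>

declare single_one [simp del] single_of_nat [simp del]

section \<open>Coordinate spaces, linear functionals and criteria for disjointness\<close>

lemma Rspace_iff: "v \<in> Rspace d \<longleftrightarrow> (\<forall>j\<ge>d. Poly_Mapping.lookup v j = 0)"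
  unfolding Rspace_def in_keys_iff subset_iff lessThan_iff mem_Collect_eq by (meson not_le)

lemma Rspace_single: "j < d \<Longrightarrow> Poly_Mapping.single j r \<in> Rspace d"
  by (auto simp: Rspace_iff lookup_single when_def)

lemma Rspace_add: "v \<in> Rspace d \<Longrightarrow> w \<in> Rspace d \<Longrightarrow> v + w \<in> Rspace d"
  by (simp add: Rspace_iff lookup_add)

lemma Rspace_diff: "v \<in> Rspace d \<Longrightarrow> w \<in> Rspace d \<Longrightarrow> v - w \<in> Rspace d"
  by (simp add: Rspace_iff lookup_minus)

lemma infinite_Rspace:
  assumes "0 < d"
  shows "infinite (Rspace d)"
proof -
  have "inj (\<lambda>m::nat. Poly_Mapping.single (0::nat) (real m))"
    by (auto intro!: injI dest!: arg_cong[of _ _ "\<lambda>v. Poly_Mapping.lookup v 0"])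
  then have "infinite (range (\<lambda>m::nat. Poly_Mapping.single (0::nat) (real m)))"
    using finite_imageD infinite_UNIV_nat by blast
  moreover have "range (\<lambda>m::nat. Poly_Mapping.single (0::nat) (real m)) \<subseteq> Rspace d"
    using assms by (intro image_subsetI Rspace_single)
  ultimately show ?thesis
    using finite_subset by blast
qed

text \<open>Pads a construction to exactly \<open>n\<close> points; the lower bounds only need
  \<open>U\<close> to contain it.\<close>

lemma Rspace_extend_card:
  assumes "0 < d" "U \<subseteq> Rspace d" "finite U" "card U \<le> n"
  obtains V where "U \<subseteq> V" "V \<subseteq> Rspace d" "finite V" "card V = n"
proof -
  have "infinite (Rspace d - U)"
    using infinite_Rspace[OF assms(1)] assms(3) by simp
  then obtain W where W: "finite W" "card W = n - card U" "W \<subseteq> Rspace d - U"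
    using infinite_arbitrarily_large by metis
  show ?thesis
  proof (rule that[of "U \<union> W"])
    have "card (U \<union> W) = card U + card W"
      using W assms by (intro card_Un_disjoint) auto
    then show "card (U \<union> W) = n" using W assms by simp
  qed (use W assms in auto)
qed

definition functional :: "nat \<Rightarrow> (nat \<Rightarrow> real) \<Rightarrow> (nat, real) poly_mapping \<Rightarrow> real" where
  "functional d c v = (\<Sum>j<d. c j * Poly_Mapping.lookup v j)"

lemma lookup_scaleR: "Poly_Mapping.lookup (r *\<^sub>R v) j = r * Poly_Mapping.lookup v j"
  for v :: "(nat, real) poly_mapping"
proof -
  have "finite {i. r * Poly_Mapping.lookup v i \<noteq> 0}"
    by (rule finite_subset[OF _ finite_lookup[of v]]) auto
  then show ?thesis
    by (simp add: scaleR_poly_mapping_def lookup_Abs_poly_mapping)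
qed

lemma linear_functional: "linear (functional d c)"
  by (rule linearI)
    (simp_all add: functional_def lookup_add lookup_scaleR algebra_simps sum.distrib sum_distrib_left)

lemma functional_single [simp]: "j < d \<Longrightarrow> functional d c (Poly_Mapping.single j r) = c j * r"
  by (simp add: functional_def lookup_single when_def if_distrib[of "\<lambda>z. _ * z"] cong: if_cong)

lemma functional_add [simp]: "functional d c (v + w) = functional d c v + functional d c w"
  by (rule linear_add[OF linear_functional])

lemma functional_diff [simp]: "functional d c (v - w) = functional d c v - functional d c w"
  by (rule linear_diff[OF linear_functional])

lemma CSD_separated:
  assumes "linear \<phi>" "\<And>x. x \<in> X \<Longrightarrow> b < \<phi> x" "\<And>y. y \<in> Y \<Longrightarrow> \<phi> y < (b::real)"
  shows "CSD X Y = 1"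
proof -
  have "convex hull X \<subseteq> \<phi> -` {b<..}"
    using assms by (intro hull_minimal convex_linear_vimage) auto
  moreover have "convex hull Y \<subseteq> \<phi> -` {..<b}"
    using assms by (intro hull_minimal convex_linear_vimage) auto
  ultimately have "convex hull X \<inter> convex hull Y = {}" by fastforce
  then show ?thesis by (simp add: CSD_def)
qed

text \<open>The common mean lies in both hulls. Points may repeat, so a closed walk alternating
  between the parties can be used as it is.\<close>

lemma CSD_common_mean:
  fixes p q :: "nat \<Rightarrow> 'v::real_vector"
  assumes k: "0 < k" and X: "\<And>i. i < k \<Longrightarrow> p i \<in> X" and Y: "\<And>i. i < k \<Longrightarrow> q i \<in> Y"
    and eq: "(\<Sum>i<k. p i) = (\<Sum>i<k. q i)"
  shows "CSD X Y = 0"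
proof -
  have mean: "(1 / real k) *\<^sub>R (\<Sum>i<k. r i) \<in> convex hull Z" if "\<And>i. i < k \<Longrightarrow> r i \<in> Z" for r :: "nat \<Rightarrow> 'v" and Z
    unfolding scaleR_right.sum
    by (rule convex_sum) (use k that in \<open>auto intro: hull_inc\<close>)
  have "(1 / real k) *\<^sub>R (\<Sum>i<k. p i) \<in> convex hull X \<inter> convex hull Y"
    using mean[of p X] mean[of q Y] X Y eq by auto
  then show ?thesis by (auto simp: CSD_def)
qed

section \<open>The planar case: points on a parabola\<close>

lemma one_le_nat_diff_square:
  assumes "y \<noteq> (x::nat)"
  shows "1 \<le> (real y - real x)\<^sup>2"
proof -
  have "1 \<le> \<bar>real y - real x\<bar>" using assms by linarith
  then show ?thesis
    using one_le_power[of "\<bar>real y - real x\<bar>" 2] by simp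
qed

definition parabola_point :: "nat \<Rightarrow> (nat, real) poly_mapping" where
  "parabola_point y = Poly_Mapping.single 0 (real y) + Poly_Mapping.single 1 ((real y)\<^sup>2)"

lemma parabola_in_Rspace: "2 \<le> d \<Longrightarrow> parabola_point y \<in> Rspace d"
  unfolding parabola_point_def by (intro Rspace_add Rspace_single) auto

lemma CSD_parabola:
  "CSD {parabola_point x} (parabola_point ` Y) = (if x \<in> Y then 0 else 1)"
proof (cases "x \<in> Y")
  case True
  then have "parabola_point x \<in> convex hull (parabola_point ` Y)"
    by (intro hull_inc imageI)
  then show ?thesis using True by (simp add: CSD_def)
next
  case False
  \<comment> \<open>The level line of this functional through the point of \<open>x\<close> is
    tangent to the parabola. Every other point with a natural abscissa lies at least 1 lower, hence
    the threshold 1/2 below the maximum.\<close>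
  define \<phi> where "\<phi> = functional 2 (\<lambda>j. if j = 0 then 2 * real x else - 1)"
  have \<phi>: "\<phi> (parabola_point y) = (real x)\<^sup>2 - (real y - real x)\<^sup>2" for y
    unfolding \<phi>_def parabola_point_def by (simp add: power2_diff)
  have "CSD {parabola_point x} (parabola_point ` Y) = 1"
  proof (rule CSD_separated)
    show "linear \<phi>" unfolding \<phi>_def by (rule linear_functional)
    show "(real x)\<^sup>2 - 1/2 < \<phi> v" if "v \<in> {parabola_point x}" for v
      using that by (simp add: \<phi>)
    fix v assume "v \<in> parabola_point ` Y"
    then obtain y where y: "v = parabola_point y" "y \<noteq> x" using False by blast
    then have "1 \<le> (real y - real x)\<^sup>2"
      by (intro one_le_nat_diff_square)
    then show "\<phi> v < (real x)\<^sup>2 - 1/2" by (simp add: y \<phi>)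
  qed
  then show ?thesis using False by simp
qed

text \<open>The case \<open>k = 1\<close>, in which parity is a single membership test.\<close>

lemma R_CSD_parabola:
  assumes n: "0 < n" and U: "finite U" "parabola_point ` {..<n} \<subseteq> U"
  shows "log 2 n / 10 \<le> R (Pow U) (Pow U) CSD"
proof -
  let ?\<alpha> = "\<lambda>x. {parabola_point (x 0)}" and ?\<beta> = "\<lambda>B. parabola_point ` {y. (0, y) \<in> B}"
  have "real 1 * log 2 n / 10 \<le> R (Pow U) (Pow U) CSD"
  proof (rule R_ge_parity[where \<alpha> = ?\<alpha> and \<beta> = ?\<beta>])
    show "CSD (?\<alpha> x) (?\<beta> B) = (if parity 1 x B then 0 else 1)" for x :: "nat \<Rightarrow> nat" and B
      using CSD_parabola[of "x 0"] parity_Suc[of 0 x B] by simp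
    show "?\<beta> B \<in> Pow U" if "B \<subseteq> {..<1} \<times> {..<n}" for B
      using that U by auto
  qed (use n U in auto)
  then show ?thesis by simp
qed

section \<open>The general case: simulating the parity automaton by edges\<close>

text \<open>
  Each pair of a level \<open>i < k\<close> and a state \<open>s\<close> owns four coordinates: one for the node and three for
  the lifted parabola points \<open>(1, y, y\<^sup>2)\<close>. The accepting final node is the initial node.
\<close>

definition node :: "nat \<Rightarrow> nat \<Rightarrow> bool \<Rightarrow> (nat, real) poly_mapping" where
  "node k i s = Poly_Mapping.single (if i = k \<and> s then 0 else 8 * i + 4 * of_bool s) 1"

text \<open>A linear functional can realize any quadratic polynomial in \<open>y\<close> on a tape,
  independently for each pair \<open>(i, s)\<close>.\<close>

definition tape :: "nat \<Rightarrow> bool \<Rightarrow> nat \<Rightarrow> (nat, real) poly_mapping" where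
  "tape i s y = Poly_Mapping.single (8 * i + 4 * of_bool s + 1) 1
     + Poly_Mapping.single (8 * i + 4 * of_bool s + 2) (real y)
     + Poly_Mapping.single (8 * i + 4 * of_bool s + 3) ((real y)\<^sup>2)"

definition alice_edge where
  "alice_edge k = (\<lambda>(i, s, y). node k i s - tape i s y)"

definition bob_edge where
  "bob_edge k = (\<lambda>(i, s, y, s'). node k (Suc i) s' - tape i s y)"

text \<open>The state depends on both inputs, so each party supplies edges for both states; Bob also
  covers every \<open>y\<close>, as he does not know \<open>x i\<close>.\<close>

definition alice_edges where
  "alice_edges k x = (\<lambda>(i, s). alice_edge k (i, s, x i)) ` ({..<k} \<times> UNIV)"

definition bob_edges where
  "bob_edges k N B = (\<lambda>(i, s, y). bob_edge k (i, s, y, s \<noteq> ((i, y) \<in> B))) ` ({..<k} \<times> UNIV \<times> {..<N})"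

definition edges where
  "edges k N = alice_edge k ` ({..<k} \<times> UNIV \<times> {..<N}) \<union> bob_edge k ` ({..<k} \<times> UNIV \<times> {..<N} \<times> UNIV)"

text \<open>The largest index is \<open>8 * k\<close>, that of the rejecting final node.\<close>

lemma edges_in_Rspace:
  assumes "8 * k + 1 \<le> d"
  shows "edges k N \<subseteq> Rspace d"
proof -
  have "node k i s \<in> Rspace d" if "i \<le> k" for i s
    unfolding node_def by (rule Rspace_single) (use that assms in \<open>auto simp: of_bool_def\<close>)
  moreover have "tape i s y \<in> Rspace d" if "i < k" for i s y
    unfolding tape_def by (intro Rspace_add Rspace_single) (use that assms in \<open>auto simp: of_bool_def\<close>)
  ultimately show ?thesis
    by (auto simp: edges_def alice_edge_def bob_edge_def intro!: Rspace_diff)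
qed

lemma finite_edges: "finite (edges k N)"
  by (simp add: edges_def)

lemma card_edges: "card (edges k N) \<le> 6 * k * N"
proof -
  have "card (edges k N) \<le> card (alice_edge k ` ({..<k} \<times> UNIV \<times> {..<N}))
      + card (bob_edge k ` ({..<k} \<times> UNIV \<times> {..<N} \<times> UNIV))"
    unfolding edges_def by (rule card_Un_le)
  also have "\<dots> \<le> card ({..<k} \<times> (UNIV :: bool set) \<times> {..<N})
      + card ({..<k} \<times> (UNIV :: bool set) \<times> {..<N} \<times> (UNIV :: bool set))"
    by (intro add_mono card_image_le) auto
  also have "\<dots> = 6 * k * N"
    by (simp add: card_cartesian_product)
  finally show ?thesis .
qed

lemma CSD_edges:
  assumes k: "0 < k" and x: "x \<in> {..<k} \<rightarrow>\<^sub>E {..<N}"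
  shows "CSD (alice_edges k x) (bob_edges k N B) = (if parity k x B then 0 else 1)"
proof (cases "parity k x B")
  case True
  let ?S = "\<lambda>i. parity i x B"
  have "CSD (alice_edges k x) (bob_edges k N B) = 0"
  proof (rule CSD_common_mean[OF k])
    show "node k i (?S i) - tape i (?S i) (x i) \<in> alice_edges k x" if "i < k" for i
      unfolding alice_edges_def alice_edge_def using that
      by (intro image_eqI[of _ _ "(i, ?S i)"]) auto
    show "node k (Suc i) (?S (Suc i)) - tape i (?S i) (x i) \<in> bob_edges k N B" if "i < k" for i
      unfolding bob_edges_def bob_edge_def using that x
      by (intro image_eqI[of _ _ "(i, ?S i, x i)"]) auto
    \<comment> \<open>An accepting run closes up: both nodes have index 0, so the node terms
      telescope to 0.\<close>
    have "node k k (?S k) = node k 0 (?S 0)"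
      using True by (simp add: node_def)
    then have "(\<Sum>i<k. node k (Suc i) (?S (Suc i)) - node k i (?S i)) = 0"
      by (simp only: sum_lessThan_telescope[of "\<lambda>i. node k i (?S i)"]) simp
    then show "(\<Sum>i<k. node k i (?S i) - tape i (?S i) (x i)) =
        (\<Sum>i<k. node k (Suc i) (?S (Suc i)) - tape i (?S i) (x i))"
      by (simp only: sum_subtractf) simp
  qed
  then show ?thesis using True by simp
next
  case False
  \<comment> \<open>The functional is a potential: \<open>P i s\<close> on nodes, and on the point \<open>y\<close> of a tape it is one less,
    plus \<open>2k (y - x i)\<^sup>2\<close> at the reached state, where this term outweighs every node an edge from
    some \<open>y \<noteq> x i\<close> could lead to. Since the run rejects, \<open>P k True = 2k - 2k = 0 = P 0 False\<close>,
    which is consistent with the identification of these two nodes.\<close>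
  define P where "P i s = (if s = parity i x B then 0 else 2 * real k) - 2 * real i" for i s
  define Q where "Q i s = (if s = parity i x B then 2 * real k else 0)" for i s
  \<comment> \<open>With \<open>j = 8 * i + 4 * of_bool s + r\<close>, the coefficient for
    \<open>r = 0\<close> is the potential of the node; those for \<open>r = 1, 2, 3\<close> expand
    \<open>P i s - 1 + Q i s * (y - x i)^2\<close>.\<close>
  define c where "c j = (let i = j div 8; s = (4 \<le> j mod 8); r = j mod 4 in
    if r = 0 then P i s else if r = 1 then P i s - 1 + Q i s * (real (x i))\<^sup>2
    else if r = 2 then - 2 * Q i s * real (x i) else Q i s)" for j :: nat
  have c: "c (8 * i + 4 * of_bool s) = P i s"
    "c (8 * i + 4 * of_bool s + 1) = P i s - 1 + Q i s * (real (x i))\<^sup>2"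
    "c (8 * i + 4 * of_bool s + 2) = - 2 * Q i s * real (x i)"
    "c (8 * i + 4 * of_bool s + 3) = Q i s" for i s
  proof -
    have "(8 * i + 4 * of_bool s + r) div 8 = i"
      "(4 \<le> (8 * i + 4 * of_bool s + r) mod 8) = s"
      "(8 * i + 4 * of_bool s + r) mod 4 = r" if "r < 4" for r
      using that by (cases s; simp; presburger)+
    from this[of 0] this[of 1] this[of 2] this[of 3] show
      "c (8 * i + 4 * of_bool s) = P i s"
      "c (8 * i + 4 * of_bool s + 1) = P i s - 1 + Q i s * (real (x i))\<^sup>2"
      "c (8 * i + 4 * of_bool s + 2) = - 2 * Q i s * real (x i)"
      "c (8 * i + 4 * of_bool s + 3) = Q i s"
      by (simp_all add: c_def Let_def)
  qed
  define \<phi> where "\<phi> = functional (8 * k + 1) c"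
  have diff: "\<phi> (v - w) = \<phi> v - \<phi> w" for v w
    by (simp add: \<phi>_def)
  have node: "\<phi> (node k i s) = P i s" if "i \<le> k" for i s
  proof (cases "i = k \<and> s")
    case True
    then show ?thesis
      using c(1)[of 0 False] \<open>\<not> parity k x B\<close> by (simp add: \<phi>_def node_def P_def)
  next
    case False
    then have "8 * i + 4 * of_bool s < 8 * k + 1"
      using that by (auto simp: of_bool_def)
    with False show ?thesis
      using c(1)[of i s] by (auto simp: \<phi>_def node_def)
  qed
  have tape: "\<phi> (tape i s y) = P i s - 1 + Q i s * (real y - real (x i))\<^sup>2" if "i < k" for i s y
  proof -
    have "8 * i + 4 * of_bool s + 3 < 8 * k + 1"
      using that by (auto simp: of_bool_def)
    then show ?thesis
      unfolding tape_def \<phi>_def using c[of i s] by (simp add: power2_eq_square algebra_simps)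
  qed
  have "CSD (alice_edges k x) (bob_edges k N B) = 1"
  proof (rule CSD_separated)
    show "linear \<phi>"
      unfolding \<phi>_def by (rule linear_functional)
  next
    fix v assume "v \<in> alice_edges k x"
    \<comment> \<open>At \<open>y = x i\<close> the square vanishes, so every edge of Alice has
      value 1.\<close>
    then show "0 < \<phi> v"
      by (auto simp: alice_edges_def alice_edge_def diff node tape)
  next
    fix v assume "v \<in> bob_edges k N B"
    then obtain i s y where i: "i < k" and v: "v = node k (Suc i) (s \<noteq> ((i, y) \<in> B)) - tape i s y"
      by (auto simp: bob_edges_def bob_edge_def)
    have eq: "\<phi> v = P (Suc i) (s \<noteq> ((i, y) \<in> B)) - (P i s - 1 + Q i s * (real y - real (x i))\<^sup>2)"
      using i by (simp add: v diff node tape)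
    show "\<phi> v < 0"
    proof (cases "s = parity i x B \<and> y \<noteq> x i")
      case True
      then have "2 * real k * 1 \<le> Q i s * (real y - real (x i))\<^sup>2"
        unfolding Q_def by (intro mult_mono one_le_nat_diff_square) auto
      then show ?thesis
        using True unfolding eq P_def by simp
    next
      \<comment> \<open>The square term vanishes. Off the run the offset \<open>2 * real k\<close>
        cannot grow, and on the run it stays 0, so the value is at most
        \<open>- 2 + 1\<close>.\<close>
      case False
      then show ?thesis
        unfolding eq by (auto simp: P_def Q_def)
    qed
  qed
  then show ?thesis using False by simp
qed

lemma R_CSD_edges:
  assumes k: "0 < k" and N: "0 < N" and U: "finite U" "edges k N \<subseteq> U"
  shows "k * log 2 N / 10 \<le> R (Pow U) (Pow U) CSD"
proof (rule R_ge_parity[where \<alpha> = "alice_edges k" and \<beta> = "bob_edges k N"])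
  show "alice_edges k x \<in> Pow U" if "x \<in> {..<k} \<rightarrow>\<^sub>E {..<N}" for x
  proof -
    have "alice_edges k x \<subseteq> edges k N"
      using that unfolding alice_edges_def edges_def by (auto intro!: UnI1 imageI)
    then show ?thesis using U by auto
  qed
  show "bob_edges k N B \<in> Pow U" for B
  proof -
    have "bob_edges k N B \<subseteq> edges k N"
      unfolding bob_edges_def edges_def by (auto intro!: UnI2 imageI)
    then show ?thesis using U by auto
  qed
qed (use assms CSD_edges in auto)

section \<open>Choice of parameters\<close>

theorem mainTheorem4:
  shows "\<exists>c::real. c > 0 \<and> (\<forall>d n::nat. d \<ge> 2 \<longrightarrow>
    (\<exists>U \<subseteq> Rspace d. finite U \<and> card U = n \<and>
      real (R (Pow U) (Pow U) CSD) \<ge> c * (real d * log 2 (real n / real d))))"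
proof (intro exI[of _ "1/960"] conjI allI impI)
  \<comment> \<open>Here \<open>960 = 10 * 96\<close>: the 10 comes from \<open>R_ge_parity\<close>,
    the 96 from \<open>d \<le> 96 * k\<close>.\<close>
  fix d n :: nat assume d: "2 \<le> d"
  then have dpos: "0 < d" by simp
  let ?goal = "\<exists>U \<subseteq> Rspace d. finite U \<and> card U = n \<and>
      real (R (Pow U) (Pow U) CSD) \<ge> 1/960 * (real d * log 2 (real n / real d))"
  consider "n < d" | "d \<le> n" "d < 48" | "d \<le> n" "48 \<le> d" by linarith
  then show ?goal
  proof cases
    case 1
    obtain U where U: "U \<subseteq> Rspace d" "finite U" "card U = n"
      using Rspace_extend_card[of d "{}" n] d by auto
    \<comment> \<open>For \<open>n = 0\<close> the argument is 0, and
      \<open>log 2 0 = 0\<close>.\<close>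
    have "log 2 (real n / real d) \<le> 0"
      using 1 d by (cases "n = 0") (auto simp: log_def divide_le_0_iff)
    then have "1/960 * (real d * log 2 (real n / real d)) \<le> 0"
      by (simp add: mult_nonneg_nonpos)
    then show ?thesis
      using U by (intro exI[of _ U]) auto
  next
    case 2
    have sub: "parabola_point ` {..<n} \<subseteq> Rspace d"
      using parabola_in_Rspace[OF d] by blast
    have card: "card (parabola_point ` {..<n}) \<le> n"
      using card_image_le[of "{..<n}" parabola_point] by simp
    obtain U where U: "parabola_point ` {..<n} \<subseteq> U" "U \<subseteq> Rspace d" "finite U" "card U = n"
      by (rule Rspace_extend_card[OF dpos sub finite_imageI[OF finite_lessThan] card])
    have nonneg: "0 \<le> log 2 (real n / real d)" and le: "log 2 (real n / real d) \<le> log 2 n"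
      using 2 d by (auto simp: field_simps)
    have "real d * log 2 (real n / real d) \<le> 96 * log 2 n"
      using 2 nonneg le by (intro mult_mono) auto
    then show ?thesis
      using U R_CSD_parabola[of n U] 2 d by (intro exI[of _ U]) auto
  next
    case 3
    \<comment> \<open>The divisor 48 ensures both \<open>8 * k + 1 \<le> d\<close> and
      \<open>12 * k \<le> d\<close>; \<open>N\<close> keeps the edge count \<open>6 * k * N\<close>
      within \<open>n\<close>.\<close>
    define k where "k = d div 48"
    define N where "N = n div (6 * k)"
    have div: "48 * k + d mod 48 = d" "d mod 48 < 48"
      unfolding k_def by simp_all
    then have "0 < k" using 3 by linarith
    with div have k: "0 < k" "48 * k \<le> d" "d \<le> 96 * k"
      by linarith+
    have n: "n < 6 * k * N + 6 * k"
      using dividend_less_times_div[of "6 * k" n] k(1) by (simp add: N_def)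
    have N: "0 < N"
      using n k 3 by (cases "N = 0") auto
    \<comment> \<open>Doubling \<open>6 * k * N\<close> absorbs the rounding in
      \<open>N\<close>.\<close>
    have "6 * k * 1 \<le> 6 * k * N" using N by (intro mult_left_mono) auto
    then have "n < 12 * k * N" using n by linarith
    also have "\<dots> \<le> d * N" using k by (intro mult_right_mono) auto
    finally have "real n \<le> real N * real d"
      using of_nat_mono[of n "d * N", where ?'a = real] by (simp add: mult.commute)
    then have "real n / real d \<le> real N"
      using d by (simp add: field_simps)
    then have le: "log 2 (real n / real d) \<le> log 2 N"
      using 3 N by (subst log_le_cancel_iff) auto
    have nonneg: "0 \<le> log 2 (real n / real d)"
      using 3 by (simp add: field_simps)
    have sub: "edges k N \<subseteq> Rspace d"
      using k by (intro edges_in_Rspace) linarith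
    have card: "card (edges k N) \<le> n"
      using card_edges[of k N] unfolding N_def by (meson le_trans times_div_less_eq_dividend)
    obtain U where U: "edges k N \<subseteq> U" "U \<subseteq> Rspace d" "finite U" "card U = n"
      by (rule Rspace_extend_card[OF dpos sub finite_edges card])
    have "real d * log 2 (real n / real d) \<le> real (96 * k) * log 2 N"
      using k nonneg le by (intro mult_mono) auto
    then show ?thesis
      using U R_CSD_edges[OF k(1) N U(3,1)] by (intro exI[of _ U]) auto
  qed
qed simp

end
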